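(* The polynomial $$F(z)=-\frac{4}{531441}(z-1)z^3\left(2z^2+3z+9\right)^3\left(8z^4+28z^3+126z^2+189z+378\right)$$ is the Shabat polynomial for the tree with passport $[3^3,1^5;2^7]$ with a black vertex of degree three at $z=0$ and a black vertex of degree one at $z=1$. That is, $F$ is a Shabat polynomial whose associated tree has passport $[3^3,1^5;2^7]$, and in this tree $z=0$ is a black vertex of degree $3$ and $z=1$ is a black vertex of degree $1$.
   Context: A Shabat polynomial is a nonconstant polynomial $F:\mathbb{C}\to\mathbb{C}$ all of whose critical values lie in $\{0,1\}$. Its associated tree (dessin) is the bicolored plane tree $F^{-1}([0,1])$, with black vertices $F^{-1}(0)$, white vertices $F^{-1}(1)$, and edges the connected components of $F^{-1}((0,1))$; the degree of a black (resp. white) vertex is the multiplicity of the corresponding root of $F$ (resp. $F-1$). The passport of the tree is the pair of lists $[b_1,\dots,b_k;w_1,\dots,w_\ell]$ of degrees of the black vertices and of the white vertices (each list taken as a multiset); within a list, $a^m$ denotes $m$ vertices of degree $a$. It is known that, up to isomorphism, there is exactly one tree (equivalently, one Shabat polynomial up to an affine change of the variable $z$) with passport $[3^3,1^5;2^7]$. *)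

theory Defs
  imports "HOL-Analysis.Analysis" "HOL-Library.Multiset"
    "HOL-Computational_Algebra.Polynomial"
begin

definition critical_values :: "complex poly \<Rightarrow> complex set" where
  "critical_values F = {poly F c |c. poly (pderiv F) c = 0}"

definition shabat_polynomial :: "complex poly \<Rightarrow> bool" where
  "shabat_polynomial F \<longleftrightarrow> degree F > 0 \<and> critical_values F \<subseteq> {0, 1}"

(* A bicolored plane graph drawn in the complex plane; edges are open arcs.
   The degree of a vertex is recorded as data, so that it can be given by
   root multiplicity. *)
record bicolored_plane_graph =
  support :: "complex set"
  black_vertices :: "complex set"
  white_vertices :: "complex set"
  edges :: "complex set set"
  vertex_degree :: "complex \<Rightarrow> nat"

(* closed_segment 0 1 and open_segment 0 1 are the real intervals [0,1] and (0,1)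
   inside the complex plane; the value of vertex_degree is meaningful only at vertices. *)
definition associated_tree :: "complex poly \<Rightarrow> bicolored_plane_graph" where
  "associated_tree F =
    \<lparr> support = poly F -` closed_segment 0 1,
      black_vertices = poly F -` {0},
      white_vertices = poly F -` {1},
      edges = components (poly F -` open_segment 0 1),
      vertex_degree = (\<lambda>v. if poly F v = 0 then order v F else order v (F - 1)) \<rparr>"

(* The two lists of degrees as multisets, black first. This is meaningful only for finite
   vertex sets (mset_set of an infinite set is empty), which is the case for the tree of
   any nonconstant polynomial. *)
definition passport :: "bicolored_plane_graph \<Rightarrow> nat multiset \<times> nat multiset" where
  "passport T =
    (image_mset (vertex_degree T) (mset_set (black_vertices T)),
     image_mset (vertex_degree T) (mset_set (white_vertices T)))"

end

theory Submission
  imports Defs "HOL-Computational_Algebra.Fundamental_Theorem_Algebra"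
begin

text \<open>
  Write \<open>F = c B\<^sup>3 R\<close>, where \<open>B = z (2z\<^sup>2 + 3z + 9)\<close> and \<open>R = (z - 1) (8z\<^sup>4 + \<dots> + 378)\<close>.  Two
  polynomial identities carry the proof, for an explicit polynomial \<open>Q\<close> of degree 7: the square
  identity \<open>F - 1 = k Q\<^sup>2\<close>, and \<open>3 B' R + B R' = 14 Q\<close>, which amounts to \<open>F' = 14 c B\<^sup>2 Q\<close>.

  The critical points are thus the roots of \<open>B\<close>, where \<open>F = 0\<close>, and those of \<open>Q\<close>, where \<open>F = 1\<close>.
  The passport requires moreover that \<open>B\<close>, \<open>R\<close> and \<open>Q\<close> have simple roots and that \<open>B\<close> and \<open>R\<close>
  have no common root, and this is already a consequence of the two identities, with no
  computation of discriminants or resultants.  Since \<open>F\<close> takes different values at the roots of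
  \<open>B R\<close> and of \<open>Q\<close>, the second identity shows that \<open>B' R\<close> does not vanish at a root of \<open>B\<close> and
  that \<open>B R'\<close> does not vanish at a root of \<open>R\<close>.  Comparing \<open>F' = 2 k Q Q'\<close> with
  \<open>F' = 14 c B\<^sup>2 Q\<close> shows that \<open>Q'\<close> is a nonzero multiple of \<open>B\<^sup>2\<close>, which does not vanish at a
  root of \<open>Q\<close>.  Over the complex numbers a polynomial with simple roots has as many roots as its
  degree, so \<open>F\<close> has 3 roots of order 3 and 5 of order 1, and \<open>F - 1\<close> has 7 roots of order 2.
\<close>

lemma image_mset_roots_rsquarefree:
  fixes p :: "complex poly"
  assumes "rsquarefree p" and "\<And>x. poly p x = 0 \<Longrightarrow> d x = m"
  shows "image_mset d (mset_set {x. poly p x = 0}) = replicate_mset (degree p) m"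
proof -
  have p: "p \<noteq> 0" using assms(1) by (simp add: rsquarefree_def)
  have fin: "finite {x. poly p x = 0}" using p by (rule poly_roots_finite)
  have "proots p = mset_set {x. poly p x = 0}"
  proof (rule multiset_eqI)
    fix x
    show "count (proots p) x = count (mset_set {x. poly p x = 0}) x"
      using assms(1) p fin
      by (cases "poly p x = 0") (auto simp: rsquarefree_root_order order_0I)
  qed
  then have "size (mset_set {x. poly p x = 0}) = degree p"
    using size_proots_complex[of p] by simp
  moreover have "image_mset d (mset_set {x. poly p x = 0}) =
      image_mset (\<lambda>_. m) (mset_set {x. poly p x = 0})"
    by (rule image_mset_cong) (use fin assms(2) in auto)
  ultimately show ?thesis by (simp add: image_mset_const_eq)
qed

lemma order_power:
  fixes p :: "'a :: idom poly"
  assumes "p \<noteq> 0"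
  shows "order x (p ^ n) = n * order x p"
  by (induction n) (use assms in \<open>auto simp: order_mult\<close>)

text \<open>
  The criterion behind the theorem: the factorizations of \<open>F\<close> and \<open>F - 1\<close>, together with a
  derivative identity, determine the passport.  No separability or coprimality is assumed.
\<close>

lemma shabat_passport_criterion:
  fixes F B R Q :: "complex poly"
  assumes F: "F = smult c (B ^ n * R)"
    and F1: "F - 1 = smult k (Q ^ 2)"
    and deriv: "of_nat n * pderiv B * R + B * pderiv R = smult m Q"
    and n: "n > 0" and m: "m \<noteq> 0" and k: "k \<noteq> 0" and deg: "degree F > 0"
  shows "shabat_polynomial F"
    and "passport (associated_tree F) =
      (replicate_mset (degree B) n + replicate_mset (degree R) 1, replicate_mset (degree Q) 2)"
    and "\<And>x. poly B x = 0 \<Longrightarrow> poly F x = 0 \<and> order x F = n"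
    and "\<And>x. poly R x = 0 \<Longrightarrow> poly F x = 0 \<and> order x F = 1"
proof -
  have F0: "F \<noteq> 0" using deg by auto
  then have c: "c \<noteq> 0" and B0: "B \<noteq> 0" and R0: "R \<noteq> 0"
    using F n by (auto simp: zero_power)
  have poly_F: "poly F x = c * (poly B x ^ n * poly R x)" for x
    by (simp add: F)
  have poly_F1: "poly F x = 1 + k * poly Q x ^ 2" for x
    using arg_cong[OF F1, of "\<lambda>p. poly p x"] by (simp add: algebra_simps)
  have poly_deriv: "of_nat n * poly (pderiv B) x * poly R x + poly B x * poly (pderiv R) x =
      m * poly Q x" for x
    using arg_cong[OF deriv, of "\<lambda>p. poly p x"] by simp
  have Bn: "B ^ n = B ^ (n - 1) * B"
    using n by (metis power_minus_mult)
  have "pderiv F = smult c (of_nat n * B ^ (n - 1) * pderiv B * R + B ^ n * pderiv R)"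
    by (simp add: F pderiv_smult pderiv_mult pderiv_power of_nat_poly algebra_simps)
  also have "\<dots> = smult c (B ^ (n - 1) * (of_nat n * pderiv B * R + B * pderiv R))"
    unfolding Bn by (simp only: algebra_simps)
  finally have dF: "pderiv F = smult (c * m) (B ^ (n - 1) * Q)"
    by (simp add: deriv)
  have "F = 1 + smult k (Q ^ 2)"
    using F1 by (simp add: algebra_simps)
  then have "pderiv F = smult k (Q * pderiv Q + Q * pderiv Q)"
    by (simp add: pderiv_add pderiv_smult power2_eq_square pderiv_mult)
  then have dF2: "pderiv F = smult (2 * k) (Q * pderiv Q)"
    by (simp only: smult_add_right smult_add_left mult_2)

  have B_root: "poly F x = 0" if "poly B x = 0" for x
    using that n by (simp add: poly_F zero_power)
  have R_root: "poly F x = 0" if "poly R x = 0" for x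
    using that by (simp add: poly_F)
  have Q_root: "poly F x = 1" if "poly Q x = 0" for x
    using that by (simp add: poly_F1)
  have zeros: "poly F x = 0 \<longleftrightarrow> poly B x = 0 \<or> poly R x = 0" for x
    using c n by (auto simp: poly_F)
  have ones: "poly F x = 1 \<longleftrightarrow> poly Q x = 0" for x
    using k by (simp add: poly_F1)

  have BR: "poly R x \<noteq> 0" and B': "poly (pderiv B) x \<noteq> 0" if "poly B x = 0" for x
    using poly_deriv[of x] B_root[OF that] Q_root[of x] that m by auto
  have R': "poly (pderiv R) x \<noteq> 0" if "poly R x = 0" for x
    using poly_deriv[of x] R_root[OF that] Q_root[of x] that m by auto
  have Q0: "Q \<noteq> 0"
    using deg F1 by auto
  \<comment> \<open>Equate the two expressions for \<open>F'\<close> and cancel \<open>Q\<close>.\<close>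
  have "Q * smult (2 * k) (pderiv Q) = Q * smult (c * m) (B ^ (n - 1))"
    using dF dF2 by (simp add: mult.commute)
  then have Q'_eq: "smult (2 * k) (pderiv Q) = smult (c * m) (B ^ (n - 1))"
    using Q0 by (simp only: mult_cancel_left) simp
  have Q': "poly (pderiv Q) x \<noteq> 0" if "poly Q x = 0" for x
  proof -
    have "poly B x \<noteq> 0" using B_root[of x] Q_root[OF that] by auto
    then show ?thesis
      using arg_cong[OF Q'_eq, of "\<lambda>p. poly p x"] c m by auto
  qed
  have sf: "rsquarefree B" "rsquarefree R" "rsquarefree Q"
    using B' R' Q' by (auto simp: rsquarefree_roots)

  have order_F: "order x F = n * order x B + order x R" for x
    using c B0 R0 by (simp add: F order_smult order_mult order_power)
  have order_B: "order x F = n" if "poly B x = 0" for x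
    using that BR[OF that] sf B0 by (simp add: order_F rsquarefree_root_order order_0I)
  have order_R: "order x F = 1" if "poly R x = 0" for x
  proof -
    have "poly B x \<noteq> 0" using that BR[of x] by auto
    then show ?thesis
      using that sf R0 by (simp add: order_F rsquarefree_root_order order_0I)
  qed
  have order_Q: "order x (F - 1) = 2" if "poly Q x = 0" for x
    using that k Q0 sf by (simp add: F1 order_smult order_power rsquarefree_root_order)

  show "poly F x = 0 \<and> order x F = n" if "poly B x = 0" for x
    using that by (simp add: B_root order_B)
  show "poly F x = 0 \<and> order x F = 1" if "poly R x = 0" for x
    using that by (simp add: R_root order_R)

  show "shabat_polynomial F"
    unfolding shabat_polynomial_def critical_values_def
    using deg c m n by (auto simp: dF B_root Q_root)

  let ?deg = "vertex_degree (associated_tree F)"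
  have black: "black_vertices (associated_tree F) = {x. poly B x = 0} \<union> {x. poly R x = 0}"
    by (auto simp: associated_tree_def zeros)
  have white: "white_vertices (associated_tree F) = {x. poly Q x = 0}"
    by (auto simp: associated_tree_def ones)
  have "mset_set (black_vertices (associated_tree F)) =
      mset_set {x. poly B x = 0} + mset_set {x. poly R x = 0}"
    unfolding black using BR
    by (intro mset_set_Union) (auto simp: poly_roots_finite B0 R0)
  moreover have "image_mset ?deg (mset_set {x. poly B x = 0}) = replicate_mset (degree B) n"
    using sf(1) by (rule image_mset_roots_rsquarefree) (simp add: associated_tree_def B_root order_B)
  moreover have "image_mset ?deg (mset_set {x. poly R x = 0}) = replicate_mset (degree R) 1"
    using sf(2) by (rule image_mset_roots_rsquarefree) (simp add: associated_tree_def R_root order_R)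
  moreover have "image_mset ?deg (mset_set {x. poly Q x = 0}) = replicate_mset (degree Q) 2"
    using sf(3) by (rule image_mset_roots_rsquarefree) (simp add: associated_tree_def Q_root order_Q)
  ultimately show "passport (associated_tree F) =
      (replicate_mset (degree B) n + replicate_mset (degree R) 1, replicate_mset (degree Q) 2)"
    by (simp add: passport_def white)
qed

theorem proposition5:
  fixes z F :: "complex poly"
  assumes "z = [:0, 1:]"
    and "F = smult (- 4 / 531441)
      ((z - 1) * z ^ 3 * (2 * z ^ 2 + 3 * z + 9) ^ 3 *
       (8 * z ^ 4 + 28 * z ^ 3 + 126 * z ^ 2 + 189 * z + 378))"
  shows "shabat_polynomial F \<and>
    passport (associated_tree F) =
      (replicate_mset 3 3 + replicate_mset 5 1, replicate_mset 7 2) \<and>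
    0 \<in> black_vertices (associated_tree F) \<and>
    vertex_degree (associated_tree F) 0 = 3 \<and>
    1 \<in> black_vertices (associated_tree F) \<and>
    vertex_degree (associated_tree F) 1 = 1"
proof -
  define B :: "complex poly" where "B = [:0, 9, 3, 2:]"
  define R :: "complex poly" where "R = [:-378, 189, 63, 98, 20, 8:]"
  \<comment> \<open>a square root of \<open>3\<^sup>1\<^sup>2 (1 - F)\<close>; note \<open>3\<^sup>1\<^sup>2 = 531441\<close>\<close>
  define Q :: "complex poly" where "Q = [:-729, 0, 0, 756, 378, 252, 56, 16:]"
  have B: "B = z * (2 * z ^ 2 + 3 * z + 9)"
    unfolding B_def assms(1) by (simp add: numeral_poly power2_eq_square)
  have R: "R = (z - 1) * (8 * z ^ 4 + 28 * z ^ 3 + 126 * z ^ 2 + 189 * z + 378)"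
    unfolding R_def assms(1) by (simp add: numeral_poly power2_eq_square eval_nat_numeral one_pCons)
  have F: "F = smult (- 4 / 531441) (B ^ 3 * R)"
    unfolding assms(2) B R by (simp add: power_mult_distrib mult_ac)
  have F1: "F - 1 = smult (- 1 / 531441) (Q ^ 2)"
    unfolding F B_def R_def Q_def
    by (simp add: power2_eq_square power3_eq_cube one_pCons)
  have deriv: "of_nat 3 * pderiv B * R + B * pderiv R = smult 14 Q"
    unfolding B_def R_def Q_def by (simp add: pderiv_pCons numeral_poly)
  have degs: "degree B = 3" "degree R = 5" "degree Q = 7"
    by (simp_all add: B_def R_def Q_def)
  have "degree F > 0"
  proof -
    have "B \<noteq> 0" "R \<noteq> 0" using degs by auto
    then show ?thesis
      unfolding F using degs by (simp add: degree_mult_eq degree_power_eq)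
  qed
  note crit = shabat_passport_criterion[OF F F1 deriv _ _ _ this, simplified]
  have "poly B 0 = 0" "poly R 1 = 0"
    by (simp_all add: B_def R_def)
  then show ?thesis
    using crit degs by (simp add: associated_tree_def)
qed

end
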